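(* (i) If $G$ is an edge $k$-colourable graph and $\lambda=\{k_1,\dots,k_q\}$ is a partition of $k$ with $k_i\le 2$ for all $i$, then $G$ is edge $\lambda$-choosable. (ii) If $n$ is an even positive integer and $\lambda=\{k_1,\dots,k_q\}$ is a partition of $n-1$ with $k_i\le 3$ for all $i$, then the complete graph $K_n$ is edge $\lambda$-choosable.
   Context: A partition of $k$ is a multiset of positive integers summing to $k$. For a partition $\lambda=\{k_1,\dots,k_q\}$ of $k$, a $\lambda$-assignment of a graph $H$ is an assignment $L$ of colour sets with $|L(v)|=k$ for all $v$ such that $\bigcup_vL(v)$ can be partitioned into sets $C_1,\dots,C_q$ with $|L(v)\cap C_i|=k_i$ for all $v$ and $i$; $H$ is $\lambda$-choosable if for every $\lambda$-assignment $L$ there is a proper colouring $f$ with $f(v)\in L(v)$ for all $v$. A graph $G$ is edge $k$-colourable (resp. edge $\lambda$-choosable) if its line graph is $k$-colourable (resp. $\lambda$-choosable). *)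

theory Defs
  imports Main "HOL-Library.Multiset"
begin

definition simple_graph :: "'a set \<Rightarrow> 'a set set \<Rightarrow> bool" where
  "simple_graph V E \<longleftrightarrow> finite V \<and> (\<forall>e\<in>E. e \<subseteq> V \<and> card e = 2)"

definition line_adj :: "'a set set \<Rightarrow> 'a set \<Rightarrow> 'a set \<Rightarrow> bool" where
  "line_adj E e f \<longleftrightarrow> e \<in> E \<and> f \<in> E \<and> e \<noteq> f \<and> e \<inter> f \<noteq> {}"

definition proper_on :: "'v set \<Rightarrow> ('v \<Rightarrow> 'v \<Rightarrow> bool) \<Rightarrow> ('v \<Rightarrow> 'c) \<Rightarrow> bool" where
  "proper_on W adj f \<longleftrightarrow> (\<forall>u\<in>W. \<forall>v\<in>W. adj u v \<longrightarrow> f u \<noteq> f v)"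

definition colourable :: "'v set \<Rightarrow> ('v \<Rightarrow> 'v \<Rightarrow> bool) \<Rightarrow> nat \<Rightarrow> bool" where
  "colourable W adj k \<longleftrightarrow> (\<exists>f::'v \<Rightarrow> nat. (\<forall>v\<in>W. f v < k) \<and> proper_on W adj f)"

definition is_partition :: "nat multiset \<Rightarrow> nat \<Rightarrow> bool" where
  "is_partition lam k \<longleftrightarrow> (\<forall>x\<in>#lam. 0 < x) \<and> sum_mset lam = k"

definition lambda_assignment ::
  "'v set \<Rightarrow> nat \<Rightarrow> nat multiset \<Rightarrow> ('v \<Rightarrow> nat set) \<Rightarrow> bool" where
  "lambda_assignment W k lam L \<longleftrightarrow>
     (\<forall>v\<in>W. finite (L v) \<and> card (L v) = k) \<and>
     (\<exists>ks C. mset ks = lam \<and>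
        (\<forall>i<length ks. \<forall>j<length ks. i \<noteq> j \<longrightarrow> C i \<inter> C j = {}) \<and>
        (\<Union>i<length ks. C i) = (\<Union>v\<in>W. L v) \<and>
        (\<forall>v\<in>W. \<forall>i<length ks. card (L v \<inter> C i) = ks ! i))"

definition lambda_choosable ::
  "'v set \<Rightarrow> ('v \<Rightarrow> 'v \<Rightarrow> bool) \<Rightarrow> nat \<Rightarrow> nat multiset \<Rightarrow> bool" where
  "lambda_choosable W adj k lam \<longleftrightarrow>
     (\<forall>L. lambda_assignment W k lam L \<longrightarrow>
        (\<exists>f. (\<forall>v\<in>W. f v \<in> L v) \<and> proper_on W adj f))"

definition edge_colourable :: "'a set set \<Rightarrow> nat \<Rightarrow> bool" where
  "edge_colourable E k \<longleftrightarrow> colourable E (line_adj E) k"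

definition edge_lambda_choosable :: "'a set set \<Rightarrow> nat \<Rightarrow> nat multiset \<Rightarrow> bool" where
  "edge_lambda_choosable E k lam \<longleftrightarrow> lambda_choosable E (line_adj E) k lam"

definition complete_edges :: "nat \<Rightarrow> nat set set" where
  "complete_edges n = {e. e \<subseteq> {0..<n} \<and> card e = 2}"

end

theory Submission
  imports Defs "HOL-Library.FuncSet" "HOL-Computational_Algebra.Polynomial" "HOL-Number_Theory.Cong"
begin

text \<open>Cut a proper edge colouring into consecutive blocks of colours, one block per part of the
  partition. Distinct parts use disjoint colour sets, so it suffices that the edges of a block of
  size \<open>r\<close> can be coloured from arbitrary lists of size \<open>r\<close>. The cases \<open>r = 2\<close> and \<open>r = 3\<close> follow
  from the Alon--Tarsi method: in a \<open>2 d\<close>-regular graph with lists of size \<open>d + 1\<close>, the graph polynomial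
  summed against Lagrange weights over all choices from the lists gives its coefficient at
  \<open>\<Prod>v. x v ^ d\<close>, whatever the lists are. Evaluated with the lists \<open>{0..d}\<close> the sum runs over
  ordinary proper colourings, and it is nonzero because they all contribute the same value. For
  \<open>r = 2\<close> this is a count in a bipartite graph. For \<open>r = 3\<close> the complete graph is
  1-factorized by sums modulo \<open>n - 1\<close>; three consecutive factors have only one 3-edge-colouring up to
  permuting the colours, and as the number of vertices is even the signs of the permutations cancel.\<close>

section \<open>The Alon--Tarsi method\<close>

text \<open>The leading coefficient of the Lagrange basis polynomial of the node \<open>c\<close> in
  \<open>A\<close>.\<close>

definition lagrange_weight :: "nat set \<Rightarrow> nat \<Rightarrow> real" where
  "lagrange_weight A c = 1 / (\<Prod>y\<in>A - {c}. real c - real y)"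

lemma lagrange_weight_nonzero:
  assumes "finite A"
  shows "lagrange_weight A c \<noteq> 0"
  using assms by (auto simp: lagrange_weight_def)

text \<open>Interpolating X^k at the \<open>d + 1\<close> nodes of \<open>A\<close> returns X^k
  itself because \<open>k \<le> d\<close>; the sum is the coefficient of X^d in the
  interpolant.\<close>

lemma sum_power_lagrange_weight:
  assumes A: "finite A" "card A = Suc d" and "k \<le> d"
  shows "(\<Sum>c\<in>A. real c ^ k * lagrange_weight A c) = (if k = d then 1 else 0)"
proof -
  define b where "b c = (\<Prod>y\<in>A - {c}. [:- real y, 1:])" for c
  define q where "q = (\<Sum>c\<in>A. smult (real c ^ k * lagrange_weight A c) (b c))"
  have deg_b: "degree (b c) = d" if "c \<in> A" for c
    using A that unfolding b_def by (subst degree_prod_sum_eq) auto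
  have coeff_b: "coeff (b c) d = 1" if "c \<in> A" for c
    using lead_coeff_prod[of "\<lambda>y. [:- real y, 1:]" "A - {c}"] deg_b[OF that]
    by (simp add: b_def)
  have interp: "poly q (real a) = real a ^ k" if a: "a \<in> A" for a
  proof -
    have "poly q (real a) = (\<Sum>c\<in>A. if c = a then real a ^ k else 0)"
      unfolding q_def poly_sum
    proof (rule sum.cong[OF refl])
      fix c assume "c \<in> A"
      show "poly (smult (real c ^ k * lagrange_weight A c) (b c)) (real a) = (if c = a then real a ^ k else 0)"
        using a A by (auto simp: b_def poly_prod lagrange_weight_def)
    qed
    then show ?thesis
      using A a by simp
  qed
  have "q = monom 1 k"
  proof (rule poly_eqI_degree[where A = "real ` A"])
    show "poly q x = poly (monom 1 k) x" if "x \<in> real ` A" for x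
      using that interp by (auto simp: poly_monom)
    have card: "card (real ` A) = Suc d"
      using A by (simp add: card_image)
    have "degree q \<le> d"
      unfolding q_def using A deg_b by (intro degree_sum_le) (auto intro: order_trans[OF degree_smult_le])
    then show "degree q < card (real ` A)"
      using card by simp
    show "degree (monom (1::real) k) < card (real ` A)"
      using card \<open>k \<le> d\<close> by (simp add: degree_monom_eq)
  qed
  then have "coeff q d = (if k = d then 1 else 0)"
    by simp
  moreover have "coeff q d = (\<Sum>c\<in>A. real c ^ k * lagrange_weight A c)"
    unfolding q_def coeff_sum using coeff_b by (intro sum.cong) auto
  ultimately show ?thesis
    by simp
qed

text \<open>The graph polynomial at \<open>x\<close> times one weight per vertex. Conflicts are
  indexed by \<open>T\<close> with a source and a target, which fixes the sign of every
  factor.\<close>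

definition alon_tarsi_term ::
  "'v set \<Rightarrow> 't set \<Rightarrow> ('t \<Rightarrow> 'v) \<Rightarrow> ('t \<Rightarrow> 'v) \<Rightarrow> ('v \<Rightarrow> nat set) \<Rightarrow> ('v \<Rightarrow> nat) \<Rightarrow> real" where
  "alon_tarsi_term W T src tgt L x =
     (\<Prod>t\<in>T. real (x (src t)) - real (x (tgt t))) * (\<Prod>v\<in>W. lagrange_weight (L v) (x v))"

text \<open>Expanding the product over \<open>T\<close>, every monomial has degree \<open>d * card W\<close>. Summed against the
  Lagrange weights it vanishes if some exponent is below \<open>d\<close>; in the only other case all exponents
  equal \<open>d\<close> and the weighted sum is 1. No term remembers the lists.\<close>

lemma alon_tarsi_sum_independent_of_lists:
  fixes L M :: "'v \<Rightarrow> nat set"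
  assumes W: "finite W" and T: "finite T" "card T = d * card W"
    and st: "\<And>t. t \<in> T \<Longrightarrow> src t \<in> W" "\<And>t. t \<in> T \<Longrightarrow> tgt t \<in> W"
    and L: "\<And>v. v \<in> W \<Longrightarrow> finite (L v) \<and> card (L v) = Suc d"
    and M: "\<And>v. v \<in> W \<Longrightarrow> finite (M v) \<and> card (M v) = Suc d"
  shows "(\<Sum>x\<in>PiE W L. alon_tarsi_term W T src tgt L x) = (\<Sum>x\<in>PiE W M. alon_tarsi_term W T src tgt M x)"
proof -
  \<comment> \<open>\<open>k A v\<close> is the exponent of \<open>x v\<close> in the monomial that
    takes the source from the factors in \<open>A\<close> and the target from the rest.\<close>
  define k where "k A v = card {t\<in>A. src t = v} + card {t\<in>T - A. tgt t = v}" for A v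
  define c where "c A = (-1 :: real) ^ (card T - card A) * (if \<forall>v\<in>W. k A v = d then 1 else 0)" for A
  have prod_group: "(\<Prod>t\<in>B. g (h t)) = (\<Prod>v\<in>W. g v ^ card {t\<in>B. h t = v})"
    if "finite B" "h ` B \<subseteq> W" for B :: "'t set" and g :: "'v \<Rightarrow> real" and h
  proof -
    have "(\<Prod>t\<in>B. g (h t)) = (\<Prod>v\<in>W. \<Prod>t\<in>{t\<in>B. h t = v}. g (h t))"
      using prod.group[OF that(1) W that(2), of "\<lambda>t. g (h t)"] by simp
    also have "\<dots> = (\<Prod>v\<in>W. g v ^ card {t\<in>B. h t = v})"
      by (intro prod.cong) (auto simp: prod.cong[where h = "\<lambda>_. g _"])
    finally show ?thesis .
  qed
  have card_group: "(\<Sum>v\<in>W. card {t\<in>B. h t = v}) = card B"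
    if "finite B" "h ` B \<subseteq> W" for B :: "'t set" and h
    using sum.group[OF that(1) W that(2), of "\<lambda>_. 1::nat"] by simp
  have "(\<Sum>x\<in>PiE W L. alon_tarsi_term W T src tgt L x) = (\<Sum>A\<in>Pow T. c A)"
    if L: "\<And>v. v \<in> W \<Longrightarrow> finite (L v) \<and> card (L v) = Suc d" for L :: "'v \<Rightarrow> nat set"
  proof -
    have "(\<Sum>x\<in>PiE W L. alon_tarsi_term W T src tgt L x) =
      (\<Sum>x\<in>PiE W L. \<Sum>A\<in>Pow T. (-1) ^ (card T - card A) *
         (\<Prod>v\<in>W. real (x v) ^ k A v * lagrange_weight (L v) (x v)))"
    proof (rule sum.cong[OF refl])
      fix x assume "x \<in> PiE W L"
      have "(\<Prod>t\<in>T. real (x (src t)) - real (x (tgt t))) =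
         (\<Sum>A\<in>Pow T. (-1) ^ (card T - card A) * (\<Prod>v\<in>W. real (x v) ^ k A v))"
        unfolding prod_diff_conv_sum'[OF T(1)]
      proof (rule sum.cong[OF refl])
        fix A assume A: "A \<in> Pow T"
        have "(\<Prod>t\<in>A. real (x (src t))) = (\<Prod>v\<in>W. real (x v) ^ card {t\<in>A. src t = v})"
          using A T st by (intro prod_group) (auto intro: finite_subset)
        moreover have "(\<Prod>t\<in>T - A. real (x (tgt t))) = (\<Prod>v\<in>W. real (x v) ^ card {t\<in>T - A. tgt t = v})"
          using A T st by (intro prod_group) auto
        ultimately show "(-1) ^ (card T - card A) * (\<Prod>t\<in>A. real (x (src t))) * (\<Prod>t\<in>T - A. real (x (tgt t))) =
            (-1) ^ (card T - card A) * (\<Prod>v\<in>W. real (x v) ^ k A v)"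
          by (simp add: k_def power_add prod.distrib)
      qed
      then show "alon_tarsi_term W T src tgt L x = (\<Sum>A\<in>Pow T. (-1) ^ (card T - card A) *
         (\<Prod>v\<in>W. real (x v) ^ k A v * lagrange_weight (L v) (x v)))"
        by (simp add: alon_tarsi_term_def sum_distrib_right prod.distrib mult.assoc)
    qed
    also have "\<dots> = (\<Sum>A\<in>Pow T. (-1) ^ (card T - card A) *
         (\<Sum>x\<in>PiE W L. \<Prod>v\<in>W. real (x v) ^ k A v * lagrange_weight (L v) (x v)))"
      by (subst sum.swap) (simp add: sum_distrib_left)
    \<comment> \<open>Monomials split over the vertices, so the sum over all choices factors into
      one-variable sums.\<close>
    also have "\<dots> = (\<Sum>A\<in>Pow T. (-1) ^ (card T - card A) *
         (\<Prod>v\<in>W. \<Sum>a\<in>L v. real a ^ k A v * lagrange_weight (L v) a))"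
      using L by (subst prod_sum_PiE[OF W]) auto
    also have "\<dots> = (\<Sum>A\<in>Pow T. c A)"
    proof (rule sum.cong[OF refl])
      fix A assume A: "A \<in> Pow T"
      have "(\<Sum>v\<in>W. card {t\<in>A. src t = v}) = card A"
        using A T st by (intro card_group) (auto intro: finite_subset)
      moreover have "(\<Sum>v\<in>W. card {t\<in>T - A. tgt t = v}) = card (T - A)"
        using A T st by (intro card_group) auto
      moreover have "card A + card (T - A) = card T"
        using A T by (metis PowD card_Diff_subset card_mono finite_subset le_add_diff_inverse)
      ultimately have total: "(\<Sum>v\<in>W. k A v) = (\<Sum>v\<in>W. d)"
        using T by (simp add: k_def sum.distrib)
      have "(\<Prod>v\<in>W. \<Sum>a\<in>L v. real a ^ k A v * lagrange_weight (L v) a) =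
        (if \<forall>v\<in>W. k A v = d then 1 else 0)"
      proof (cases "\<exists>v\<in>W. k A v < d")
        case True
        then obtain v where v: "v \<in> W" "k A v < d" by blast
        then have "(\<Sum>a\<in>L v. real a ^ k A v * lagrange_weight (L v) a) = 0"
          using sum_power_lagrange_weight[of "L v" d "k A v"] L[of v] by simp
        then have "(\<Prod>v\<in>W. \<Sum>a\<in>L v. real a ^ k A v * lagrange_weight (L v) a) = 0"
          using v by (intro prod_zero[OF W]) blast
        moreover have "\<not> (\<forall>v\<in>W. k A v = d)"
          using v by (metis less_irrefl)
        ultimately show ?thesis
          by simp
      next
        case False
        then have ge: "d \<le> k A v" if "v \<in> W" for v
          using that by force
        \<comment> \<open>The exponents average \<open>d\<close>; if none is smaller, none is
          larger.\<close>
        have all: "\<forall>v\<in>W. k A v = d"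
        proof
          fix v assume "v \<in> W"
          from sum_mono_inv[OF total[symmetric] ge this W] show "k A v = d"
            by simp
        qed
        then have "(\<Sum>a\<in>L v. real a ^ k A v * lagrange_weight (L v) a) = 1" if "v \<in> W" for v
          using sum_power_lagrange_weight[of "L v" d "k A v"] L[OF that] that by simp
        then show ?thesis
          using all by simp
      qed
      then show "(-1) ^ (card T - card A) *
         (\<Prod>v\<in>W. \<Sum>a\<in>L v. real a ^ k A v * lagrange_weight (L v) a) = c A"
        by (simp add: c_def)
    qed
    finally show ?thesis .
  qed
  from this[OF L] this[OF M] show ?thesis
    by simp
qed

text \<open>Without a list colouring every term over \<open>L\<close> vanishes, hence so does the
  sum over the lists \<open>{..d}\<close>. There only proper colourings count, each contributes
  \<open>c\<close>, and \<open>y\<close> provides at least one, so that sum is nonzero.\<close>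

lemma alon_tarsi_list_colouring:
  fixes L M :: "'v \<Rightarrow> nat set"
  assumes W: "finite W" and T: "finite T" "card T = d * card W"
    and st: "\<And>t. t \<in> T \<Longrightarrow> src t \<in> W" "\<And>t. t \<in> T \<Longrightarrow> tgt t \<in> W"
    and L: "\<And>v. v \<in> W \<Longrightarrow> finite (L v) \<and> card (L v) = Suc d"
    and y: "\<And>v. v \<in> W \<Longrightarrow> y v \<le> d" "\<And>t. t \<in> T \<Longrightarrow> y (src t) \<noteq> y (tgt t)"
    and c: "c \<noteq> 0" "\<And>x. x \<in> W \<rightarrow> {..d} \<Longrightarrow> (\<And>t. t \<in> T \<Longrightarrow> x (src t) \<noteq> x (tgt t)) \<Longrightarrow>
              alon_tarsi_term W T src tgt (\<lambda>_. {..d}) x = c"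
  shows "\<exists>f. (\<forall>v\<in>W. f v \<in> L v) \<and> (\<forall>t\<in>T. f (src t) \<noteq> f (tgt t))"
proof (rule ccontr)
  assume no: "\<not> ?thesis"
  have zero: "alon_tarsi_term W T src tgt M x = 0" if "t \<in> T" "x (src t) = x (tgt t)" for M x t
    using T that by (auto simp: alon_tarsi_term_def intro!: prod_zero)
  define S where "S = {x \<in> PiE W (\<lambda>_. {..d}). \<forall>t\<in>T. x (src t) \<noteq> x (tgt t)}"
  have fin: "finite (PiE W (\<lambda>_. {..d}))"
    using W by (intro finite_PiE) auto
  have "restrict y W \<in> S"
    using y st by (auto simp: S_def)
  moreover have "finite S"
    using fin by (simp add: S_def)
  ultimately have "card S \<noteq> 0"
    by auto
  have "(\<Sum>x\<in>PiE W (\<lambda>_. {..d}). alon_tarsi_term W T src tgt (\<lambda>_. {..d}) x) =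
        (\<Sum>x\<in>S. alon_tarsi_term W T src tgt (\<lambda>_. {..d}) x)"
    using fin zero by (intro sum.mono_neutral_right) (auto simp: S_def)
  also have "\<dots> = (\<Sum>x\<in>S. c)"
    by (intro sum.cong refl c) (auto simp: S_def PiE_def)
  finally have "(\<Sum>x\<in>PiE W (\<lambda>_. {..d}). alon_tarsi_term W T src tgt (\<lambda>_. {..d}) x) \<noteq> 0"
    using \<open>card S \<noteq> 0\<close> c by simp
  moreover have "(\<Sum>x\<in>PiE W L. alon_tarsi_term W T src tgt L x) = 0"
  proof (rule sum.neutral, rule ballI)
    fix x assume "x \<in> PiE W L"
    then obtain t where "t \<in> T" "x (src t) = x (tgt t)"
      using no by (auto simp: PiE_def Pi_def)
    then show "alon_tarsi_term W T src tgt L x = 0"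
      by (rule zero)
  qed
  moreover have "(\<Sum>x\<in>PiE W L. alon_tarsi_term W T src tgt L x) =
    (\<Sum>x\<in>PiE W (\<lambda>_. {..d}). alon_tarsi_term W T src tgt (\<lambda>_. {..d}) x)"
    using W T st L by (intro alon_tarsi_sum_independent_of_lists) auto
  ultimately show False
    by simp
qed

section \<open>Blocks of at most two colours\<close>

definition choosable :: "'v set \<Rightarrow> ('v \<Rightarrow> 'v \<Rightarrow> bool) \<Rightarrow> nat \<Rightarrow> bool" where
  "choosable W adj r \<longleftrightarrow>
     (\<forall>L :: 'v \<Rightarrow> nat set. (\<forall>v\<in>W. finite (L v) \<and> card (L v) = r) \<longrightarrow>
        (\<exists>f. (\<forall>v\<in>W. f v \<in> L v) \<and> proper_on W adj f))"

text \<open>Locates a colour in the consecutive intervals of lengths \<open>ks\<close>. The last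
  inequality records that the interval stays inside the range of colours.\<close>

lemma sum_list_block:
  fixes n :: nat
  assumes "n < sum_list ks"
  shows "\<exists>i<length ks. sum_list (take i ks) \<le> n \<and> n < sum_list (take i ks) + ks ! i \<and>
           sum_list (take i ks) + ks ! i \<le> sum_list ks"
  using assms
proof (induction ks arbitrary: n)
  case (Cons a ks)
  show ?case
  proof (cases "n < a")
    case True
    then show ?thesis
      by (intro exI[of _ 0]) auto
  next
    case False
    then have "n - a < sum_list ks"
      using Cons.prems by simp
    from Cons.IH[OF this] obtain i where "i < length ks" "sum_list (take i ks) \<le> n - a"
      "n - a < sum_list (take i ks) + ks ! i" "sum_list (take i ks) + ks ! i \<le> sum_list ks"
      by blast
    then show ?thesis
      using False by (intro exI[of _ "Suc i"]) auto
  qed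
qed simp

text \<open>A vertex in block \<open>i\<close> is coloured from \<open>L v \<inter> C i\<close>,
  which has \<open>ks ! i\<close> elements. Neighbours in one block differ because the block is
  choosable, neighbours in different blocks because the \<open>C i\<close> are disjoint.\<close>

lemma lambda_choosable_of_blocks:
  assumes lam: "sum_mset lam = k"
    and g: "\<And>v. v \<in> W \<Longrightarrow> g v < k"
    and blocks: "\<And>s r. r \<in># lam \<Longrightarrow> s + r \<le> k \<Longrightarrow> choosable {v\<in>W. s \<le> g v \<and> g v < s + r} adj r"
  shows "lambda_choosable W adj k lam"
  unfolding lambda_choosable_def
proof (intro allI impI)
  fix L assume assignment: "lambda_assignment W k lam L"
  then have L: "\<And>v. v \<in> W \<Longrightarrow> finite (L v)"
    by (simp add: lambda_assignment_def)
  obtain ks C where ks: "mset ks = lam"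
    and C: "\<And>i j. i < length ks \<Longrightarrow> j < length ks \<Longrightarrow> i \<noteq> j \<Longrightarrow> C i \<inter> C j = {}"
    and card_C: "\<And>v i. v \<in> W \<Longrightarrow> i < length ks \<Longrightarrow> card (L v \<inter> C i) = ks ! i"
    using assignment unfolding lambda_assignment_def by metis
  define S where "S i = sum_list (take i ks)" for i
  define B where "B i = {v\<in>W. S i \<le> g v \<and> g v < S i + ks ! i}" for i
  have k: "sum_list ks = k"
    using lam ks by (metis sum_mset_sum_list)
  have "\<forall>v\<in>W. \<exists>i. i < length ks \<and> v \<in> B i \<and> S i + ks ! i \<le> k"
    using sum_list_block[of _ ks] g by (auto simp: k B_def S_def)
  then obtain b where b: "\<And>v. v \<in> W \<Longrightarrow> b v < length ks \<and> v \<in> B (b v) \<and> S (b v) + ks ! b v \<le> k"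
    by metis
  have "\<exists>f. (\<forall>v\<in>B i. f v \<in> L v \<inter> C i) \<and> proper_on (B i) adj f" if "i < length ks" "S i + ks ! i \<le> k" for i
  proof -
    have "choosable (B i) adj (ks ! i)"
      unfolding B_def using that ks by (intro blocks) auto
    moreover have "\<forall>v\<in>B i. finite (L v \<inter> C i) \<and> card (L v \<inter> C i) = ks ! i"
      using L card_C that by (auto simp: B_def)
    ultimately show ?thesis
      unfolding choosable_def by (elim allE[of _ "\<lambda>v. L v \<inter> C i"]) blast
  qed
  then obtain F where F: "\<And>i. i < length ks \<Longrightarrow> S i + ks ! i \<le> k \<Longrightarrow>
      (\<forall>v\<in>B i. F i v \<in> L v \<inter> C i) \<and> proper_on (B i) adj (F i)"
    by metis
  define f where "f v = F (b v) v" for v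
  have f: "f v \<in> L v \<inter> C (b v)" if "v \<in> W" for v
    using F[of "b v"] b[OF that] by (auto simp: f_def)
  have "f u \<noteq> f v" if uv: "u \<in> W" "v \<in> W" "adj u v" for u v
  proof (cases "b u = b v")
    case True
    then show ?thesis
      using F[of "b u"] b[OF uv(1)] b[OF uv(2)] uv(3) by (simp add: f_def proper_on_def)
  next
    case False
    then have "C (b u) \<inter> C (b v) = {}"
      using C b uv by blast
    then show ?thesis
      using f[OF uv(1)] f[OF uv(2)] by auto
  qed
  then show "\<exists>f. (\<forall>v\<in>W. f v \<in> L v) \<and> proper_on W adj f"
    using f by (auto simp: proper_on_def)
qed

lemma choosable_independent:
  assumes "\<And>u v. u \<in> W \<Longrightarrow> v \<in> W \<Longrightarrow> \<not> adj u v" "0 < r"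
  shows "choosable W adj r"
  unfolding choosable_def
proof (intro allI impI)
  fix L :: "'a \<Rightarrow> nat set"
  assume L: "\<forall>v\<in>W. finite (L v) \<and> card (L v) = r"
  have "\<forall>v\<in>W. \<exists>c. c \<in> L v"
    using L \<open>0 < r\<close> by (metis card.empty ex_in_conv less_irrefl)
  then obtain f where "\<forall>v\<in>W. f v \<in> L v"
    by metis
  then show "\<exists>f. (\<forall>v\<in>W. f v \<in> L v) \<and> proper_on W adj f"
    using assms(1) by (auto simp: proper_on_def)
qed

section \<open>Lists of two colours on bipartite graphs of maximum degree two\<close>

lemma prod_neg_one_power:
  "(\<Prod>a\<in>A. (-1 :: real) ^ f a) = (-1) ^ (\<Sum>a\<in>A. f a)"
  by (rule power_sum[symmetric])

text \<open>Each edge has one end in either class, so in a 2-regular bipartite graph the signs cancel in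
  pairs and the colour 1 is used exactly \<open>card A\<close> times by every proper colouring with 0 and 1.\<close>

lemma choosable_2_bipartite_regular:
  fixes P :: "'v \<Rightarrow> bool"
  assumes W: "finite W" and sym: "\<And>u v. adj u v \<Longrightarrow> adj v u"
    and bip: "\<And>u v. u \<in> W \<Longrightarrow> v \<in> W \<Longrightarrow> adj u v \<Longrightarrow> P u \<noteq> P v"
    and deg: "\<And>v. v \<in> W \<Longrightarrow> card {u\<in>W. adj v u} = 2"
  shows "choosable W adj 2"
  unfolding choosable_def
proof (intro allI impI)
  fix L :: "'v \<Rightarrow> nat set"
  assume L: "\<forall>v\<in>W. finite (L v) \<and> card (L v) = 2"
  define A where "A = {v\<in>W. P v}"
  define B where "B = {v\<in>W. \<not> P v}"
  define N where "N v = {u\<in>W. adj v u}" for v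
  define T where "T = Sigma A N"
  have fin: "finite A" "finite B" "\<And>v. finite (N v)"
    using W by (auto simp: A_def B_def N_def)
  have T_swap: "T = prod.swap ` Sigma B N"
  proof -
    have "(u, v) \<in> T \<longleftrightarrow> (v, u) \<in> Sigma B N" for u v
      using bip[of u v] bip[of v u] sym[of u v] sym[of v u] by (auto simp: T_def A_def B_def N_def)
    then show ?thesis
      by (auto simp: image_iff)
  qed
  have sum_fst: "(\<Sum>t\<in>T. h (fst t)) = 2 * (\<Sum>v\<in>A. h v)" for h :: "'v \<Rightarrow> nat"
  proof -
    have "(\<Sum>t\<in>T. h (fst t)) = (\<Sum>v\<in>A. \<Sum>u\<in>N v. h v)"
      unfolding T_def using fin by (subst sum.Sigma) (auto intro: sum.cong)
    also have "\<dots> = (\<Sum>v\<in>A. 2 * h v)"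
      using deg by (intro sum.cong) (auto simp: A_def N_def)
    finally show ?thesis
      by (simp add: sum_distrib_left)
  qed
  have sum_snd: "(\<Sum>t\<in>T. h (snd t)) = 2 * (\<Sum>v\<in>B. h v)" for h :: "'v \<Rightarrow> nat"
  proof -
    have "(\<Sum>t\<in>T. h (snd t)) = (\<Sum>t\<in>Sigma B N. h (fst t))"
      unfolding T_swap by (subst sum.reindex) auto
    also have "\<dots> = (\<Sum>v\<in>B. \<Sum>u\<in>N v. h v)"
      using fin by (subst sum.Sigma) (auto intro: sum.cong)
    also have "\<dots> = (\<Sum>v\<in>B. 2 * h v)"
      using deg by (intro sum.cong) (auto simp: B_def N_def)
    finally show ?thesis
      by (simp add: sum_distrib_left)
  qed
  have sum_W: "(\<Sum>v\<in>A. h v) + (\<Sum>v\<in>B. h v) = (\<Sum>v\<in>W. h v)" for h :: "'v \<Rightarrow> nat"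
    using W by (subst sum.union_disjoint[symmetric]) (auto simp: A_def B_def intro: sum.cong)
  have card_T: "card T = 2 * card A" "card T = 2 * card B"
    using sum_fst[of "\<lambda>_. 1"] sum_snd[of "\<lambda>_. 1"] by simp_all
  have card_W: "card W = card A + card B"
    using sum_W[of "\<lambda>_. 1"] by simp
  have T_edges: "fst t \<in> W" "snd t \<in> W" "adj (fst t) (snd t)" "P (fst t)" "\<not> P (snd t)" if "t \<in> T" for t
    using that bip by (auto simp: T_def A_def N_def)
  have weight: "lagrange_weight {..Suc 0} c = (-1) ^ Suc c" if "c \<le> 1" for c
  proof -
    have "{..Suc 0} - {0} = {1}" "{..Suc 0} - {Suc 0} = {0}" by auto
    then show ?thesis
      using that by (cases c) (auto simp: lagrange_weight_def)
  qed
  have "\<exists>f. (\<forall>v\<in>W. f v \<in> L v) \<and> (\<forall>t\<in>T. f (fst t) \<noteq> f (snd t))"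
  proof (rule alon_tarsi_list_colouring[where d = 1 and y = "\<lambda>v. if P v then 1 else 0"
        and c = "(-1) ^ (card W + card A)"])
    show "finite T"
      using fin by (simp add: T_def)
    show "card T = 1 * card W"
      using card_T card_W by simp
    fix x assume x: "x \<in> W \<rightarrow> {..1::nat}" "\<And>t. t \<in> T \<Longrightarrow> x (fst t) \<noteq> x (snd t)"
    have bit: "x v = 0 \<or> x v = 1" if "v \<in> W" for v
      using x(1) that by (force simp: le_Suc_eq)
    have "(\<Prod>t\<in>T. real (x (fst t)) - real (x (snd t))) = (\<Prod>t\<in>T. (-1) ^ Suc (x (fst t)))"
    proof (rule prod.cong[OF refl])
      fix t assume "t \<in> T"
      then show "real (x (fst t)) - real (x (snd t)) = (-1) ^ Suc (x (fst t))"
        using bit[of "fst t"] bit[of "snd t"] x(2)[of t] T_edges[of t] by auto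
    qed
    then have edges: "(\<Prod>t\<in>T. real (x (fst t)) - real (x (snd t))) = 1"
      using sum_fst[of "\<lambda>v. Suc (x v)"] by (simp only: prod_neg_one_power) simp
    \<comment> \<open>Every edge has exactly one end of colour 1 and every vertex has degree 2, so
      twice the number of ones is \<open>card T = 2 * card A\<close>.\<close>
    have "(\<Sum>t\<in>T. x (fst t) + x (snd t)) = (\<Sum>t\<in>T. 1)"
    proof (rule sum.cong[OF refl])
      fix t assume "t \<in> T"
      then show "x (fst t) + x (snd t) = 1"
        using bit[of "fst t"] bit[of "snd t"] x(2)[of t] T_edges[of t] by auto
    qed
    then have ones: "(\<Sum>v\<in>W. x v) = card A"
      using sum_fst[of x] sum_snd[of x] sum_W[of x] card_T by (simp add: sum.distrib)
    have "(\<Prod>v\<in>W. lagrange_weight {..1} (x v)) = (\<Prod>v\<in>W. (-1) ^ Suc (x v))"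
      using bit weight by (intro prod.cong) fastforce+
    also have "\<dots> = (-1) ^ (\<Sum>v\<in>W. Suc (x v))"
      by (rule prod_neg_one_power)
    also have "(\<Sum>v\<in>W. Suc (x v)) = card W + card A"
      using ones by (simp add: sum_Suc add.commute)
    finally show "alon_tarsi_term W T fst snd (\<lambda>_. {..1}) x = (-1) ^ (card W + card A)"
      using edges by (simp add: alon_tarsi_term_def)
  qed (use W L T_edges in auto)
  then obtain f where f: "\<And>v. v \<in> W \<Longrightarrow> f v \<in> L v" "\<And>t. t \<in> T \<Longrightarrow> f (fst t) \<noteq> f (snd t)"
    by blast
  have "f u \<noteq> f v" if "u \<in> W" "v \<in> W" "adj u v" for u v
    using that f(2)[of "(u, v)"] f(2)[of "(v, u)"] bip[of u v] sym[of u v]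
    by (auto simp: T_def A_def N_def)
  then show "\<exists>f. (\<forall>v\<in>W. f v \<in> L v) \<and> proper_on W adj f"
    using f(1) by (auto simp: proper_on_def)
qed

text \<open>The fewer than \<open>r\<close> neighbours of \<open>v\<close>, coloured first, cannot
  use up the \<open>r\<close> colours in its list.\<close>

lemma choosable_remove_vertex:
  assumes W: "finite W" and v: "v \<in> W" and sym: "\<And>u v. adj u v \<Longrightarrow> adj v u"
    and irrefl: "\<not> adj v v" and deg: "card {u\<in>W. adj v u} < r"
    and IH: "choosable (W - {v}) adj r"
  shows "choosable W adj r"
  unfolding choosable_def
proof (intro allI impI)
  fix L :: "'a \<Rightarrow> nat set"
  assume L: "\<forall>v\<in>W. finite (L v) \<and> card (L v) = r"
  have "\<exists>f. (\<forall>u\<in>W - {v}. f u \<in> L u) \<and> proper_on (W - {v}) adj f"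
    using IH L by (simp add: choosable_def)
  then obtain f where f: "\<And>u. u \<in> W - {v} \<Longrightarrow> f u \<in> L u" "proper_on (W - {v}) adj f"
    by blast
  let ?N = "{u\<in>W. adj v u}"
  have "card (f ` ?N) < card (L v)"
    using card_image_le[of ?N f] W deg L v by auto
  moreover have "finite (f ` ?N)"
    using W by simp
  ultimately have "\<not> L v \<subseteq> f ` ?N"
    using card_mono by (metis leD)
  then obtain c where c: "c \<in> L v" "c \<notin> f ` ?N"
    by blast
  have "proper_on W adj (f(v := c))"
    using c f(2) sym irrefl by (auto simp: proper_on_def)
  then show "\<exists>f. (\<forall>v\<in>W. f v \<in> L v) \<and> proper_on W adj f"
    using f(1) c by (intro exI[of _ "f(v := c)"]) auto
qed

text \<open>Induction on \<open>W\<close>: a vertex of degree below 2 is removed and coloured last;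
  when there is none, the graph is 2-regular.\<close>

lemma choosable_2_bipartite:
  fixes P :: "'v \<Rightarrow> bool"
  assumes "finite W" and sym: "\<And>u v. adj u v \<Longrightarrow> adj v u"
    and "\<And>u v. u \<in> W \<Longrightarrow> v \<in> W \<Longrightarrow> adj u v \<Longrightarrow> P u \<noteq> P v"
    and "\<And>v. v \<in> W \<Longrightarrow> card {u\<in>W. adj v u} \<le> 2"
  shows "choosable W adj 2"
  using assms(1,3,4)
proof (induction W rule: finite_psubset_induct)
  case (psubset W)
  show ?case
  proof (cases "\<exists>v\<in>W. card {u\<in>W. adj v u} < 2")
    case True
    then obtain v where v: "v \<in> W" "card {u\<in>W. adj v u} < 2" by blast
    show ?thesis
    proof (rule choosable_remove_vertex[OF psubset.hyps v(1) sym])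
      show "\<not> adj v v"
        using psubset.prems(1) v by blast
      show "choosable (W - {v}) adj 2"
      proof (rule psubset.IH)
        fix w assume w: "w \<in> W - {v}"
        have "card {u\<in>W - {v}. adj w u} \<le> card {u\<in>W. adj w u}"
          using psubset.hyps by (intro card_mono) auto
        then show "card {u\<in>W - {v}. adj w u} \<le> 2"
          using psubset.prems(2)[of w] w by auto
      qed (use v psubset.prems(1) in auto)
    qed (use v in auto)
  next
    case False
    then have "card {u\<in>W. adj v u} = 2" if "v \<in> W" for v
      using psubset.prems(2)[OF that] that by force
    then show ?thesis
      using psubset.hyps psubset.prems(1) sym by (intro choosable_2_bipartite_regular[where P = P])
  qed
qed

section \<open>One or two classes of an edge colouring\<close>

lemma line_adj_sym: "line_adj E e f \<Longrightarrow> line_adj E f e"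
  by (auto simp: line_adj_def)

lemma line_adj_proper:
  assumes "proper_on E (line_adj E) g" "e \<in> E" "f \<in> E" "v \<in> e" "v \<in> f" "g e = g f"
  shows "e = f"
  using assms by (auto simp: proper_on_def line_adj_def)

text \<open>A single class is a matching, so independent in the line graph. Two classes are the
  sides of a bipartite graph, and an edge has at each of its two ends at most one neighbour in the
  other class.\<close>

lemma choosable_block_le_2:
  assumes E: "simple_graph V E" and g: "proper_on E (line_adj E) g" and r: "0 < r" "r \<le> 2"
  shows "choosable {e\<in>E. s \<le> g e \<and> g e < s + r} (line_adj E) r"
proof (cases "r = 1")
  case True
  show ?thesis
  proof (rule choosable_independent)
    fix u v assume "u \<in> {e\<in>E. s \<le> g e \<and> g e < s + r}" "v \<in> {e\<in>E. s \<le> g e \<and> g e < s + r}"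
    then have "u \<in> E" "v \<in> E" "g u = g v"
      using True by auto
    then show "\<not> line_adj E u v"
      using g by (auto simp: proper_on_def)
  qed (use r in simp)
next
  case False
  then have r2: "r = 2"
    using r by simp
  let ?W = "{e\<in>E. s \<le> g e \<and> g e < s + 2}"
  have fin: "finite E"
    using E by (auto simp: simple_graph_def intro: finite_subset[of E "Pow V"])
  have "choosable ?W (line_adj E) 2"
  proof (rule choosable_2_bipartite[where P = "\<lambda>e. g e = s"])
    fix e assume e: "e \<in> ?W"
    then obtain a b where ab: "e = {a, b}"
      using E by (auto simp: simple_graph_def card_2_iff)
    define M where "M v = {f\<in>?W. v \<in> f \<and> g f \<noteq> g e}" for v
    have M: "card (M v) \<le> 1" for v
    proof -
      have "f = f'" if "f \<in> M v" "f' \<in> M v" for f f'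
      proof (rule line_adj_proper[OF g])
        \<comment> \<open>Only \<open>s\<close> and \<open>s + 1\<close> occur in the block, so
          edges that avoid the colour \<open>g e\<close> agree.\<close>
        show "g f = g f'"
          using that e by (auto simp: M_def)
      qed (use that in \<open>auto simp: M_def\<close>)
      then show ?thesis
        using fin by (intro card_le_Suc0_iff_eq[THEN iffD2, folded One_nat_def]) (auto simp: M_def)
    qed
    have "f \<in> M a \<union> M b" if f: "f \<in> ?W" "line_adj E e f" for f
    proof -
      have "g e \<noteq> g f"
        using g e f by (auto simp: proper_on_def)
      moreover have "a \<in> f \<or> b \<in> f"
        using f(2) ab by (auto simp: line_adj_def)
      ultimately show ?thesis
        using f(1) by (auto simp: M_def)
    qed
    then have "{f\<in>?W. line_adj E e f} \<subseteq> M a \<union> M b"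
      by blast
    then have "card {f\<in>?W. line_adj E e f} \<le> card (M a \<union> M b)"
      using fin by (intro card_mono) (auto simp: M_def)
    also have "\<dots> \<le> 2"
      using card_Un_le[of "M a" "M b"] M[of a] M[of b] by simp
    finally show "card {f\<in>?W. line_adj E e f} \<le> 2" .
  next
    fix u v assume "u \<in> ?W" "v \<in> ?W" "line_adj E u v"
    moreover from this have "g u \<noteq> g v"
      using g by (auto simp: proper_on_def)
    ultimately show "(g u = s) \<noteq> (g v = s)"
      by auto
  qed (use fin line_adj_sym in auto)
  then show ?thesis
    by (simp add: r2)
qed

section \<open>A 1-factorization of the complete graph\<close>

text \<open>Modulo the odd number \<open>N\<close>, an edge is coloured by the sum of its ends; the extra vertex \<open>N\<close>
  plays the role of infinity and lends its edges the colour that a loop at the other end would get.\<close>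

definition sum_colour :: "nat \<Rightarrow> nat set \<Rightarrow> nat" where
  "sum_colour N e = (if N \<in> e then 2 * \<Sum>(e - {N}) else \<Sum>e) mod N"

lemma sum_colour_finite:
  assumes "u < N" "v < N" "u \<noteq> v"
  shows "sum_colour N {u, v} = (u + v) mod N"
  using assms by (simp add: sum_colour_def)

lemma sum_colour_infinity:
  assumes "u < N"
  shows "sum_colour N {u, N} = (u + u) mod N" "sum_colour N {N, u} = (u + u) mod N"
  using assms by (simp_all add: sum_colour_def insert_Diff_if mult_2)

lemma sum_colour_less: "0 < N \<Longrightarrow> sum_colour N e < N"
  by (simp add: sum_colour_def)

lemma complete_edges_pair: "{u, v} \<in> complete_edges n \<longleftrightarrow> u < n \<and> v < n \<and> u \<noteq> v"
  by (auto simp: complete_edges_def card_2_iff doubleton_eq_iff)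

lemma complete_edgesE:
  assumes "e \<in> complete_edges n" "t \<in> e"
  obtains v where "e = {t, v}" "t < n" "v < n" "t \<noteq> v"
proof -
  from assms obtain a b where ab: "e = {a, b}" "a \<noteq> b" "a < n" "b < n"
    by (auto simp: complete_edges_def card_2_iff)
  then show ?thesis
    using that[of a] that[of b] assms(2) by (auto simp: insert_commute)
qed

lemma add_mod_cancel:
  fixes a b c N :: nat
  assumes "(a + b) mod N = (a + c) mod N" "b < N" "c < N"
  shows "b = c"
  using assms cong_add_lcancel_nat[of a b c N] by (simp add: cong_def)

lemma double_mod_cancel:
  fixes b c N :: nat
  assumes "(b + b) mod N = (c + c) mod N" "b < N" "c < N" "odd N"
  shows "b = c"
proof -
  have "[2 * b = 2 * c] (mod N)"
    using assms by (simp add: cong_def mult_2)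
  moreover have "coprime 2 N"
    using \<open>odd N\<close> by simp
  ultimately show ?thesis
    using assms cong_mult_lcancel_nat[of 2 N b c] by (simp add: cong_def)
qed

text \<open>At infinity the colours are doubles, distinct since 2 is invertible modulo the odd
  \<open>N\<close>. At a finite \<open>t\<close> the edge to infinity has colour
  \<open>t + t\<close>, the one sum that no edge from \<open>t\<close> to a finite vertex
  attains.\<close>

lemma sum_colour_inj:
  assumes N: "odd N" and t: "t < Suc N"
    and v: "v < Suc N" "v \<noteq> t" and w: "w < Suc N" "w \<noteq> t"
    and eq: "sum_colour N {t, v} = sum_colour N {t, w}"
  shows "v = w"
proof (cases "t = N")
  case True
  then show ?thesis
    using v w eq N by (auto simp: sum_colour_infinity intro: double_mod_cancel)
next
  case False
  then have col: "sum_colour N {t, x} = (t + (if x = N then t else x)) mod N" if "x < Suc N" "x \<noteq> t" for x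
    using that t by (auto simp: sum_colour_infinity sum_colour_finite)
  have "(if v = N then t else v) = (if w = N then t else w)"
  proof (rule add_mod_cancel)
    show "(t + (if v = N then t else v)) mod N = (t + (if w = N then t else w)) mod N"
      using col[OF v] col[OF w] eq by simp
  qed (use v w t False in auto)
  then show ?thesis
    using v w by (auto split: if_splits)
qed

lemma proper_sum_colour:
  assumes "odd N"
  shows "proper_on (complete_edges (Suc N)) (line_adj (complete_edges (Suc N))) (sum_colour N)"
  unfolding proper_on_def
proof (intro ballI impI notI)
  fix e f
  assume ef: "e \<in> complete_edges (Suc N)" "f \<in> complete_edges (Suc N)"
    "line_adj (complete_edges (Suc N)) e f" "sum_colour N e = sum_colour N f"
  then obtain t where t: "t \<in> e" "t \<in> f" "e \<noteq> f"
    by (auto simp: line_adj_def)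
  obtain v where v: "e = {t, v}" "t < Suc N" "v < Suc N" "t \<noteq> v"
    using complete_edgesE[OF ef(1) t(1)] .
  obtain w where w: "f = {t, w}" "w < Suc N" "t \<noteq> w"
    using complete_edgesE[OF ef(2) t(2)] .
  have "v = w"
    using sum_colour_inj[OF assms v(2,3) _ w(2)] v w ef(4) by auto
  then show False
    using v w t by simp
qed

text \<open>Existence by counting: the \<open>N\<close> edges at \<open>t\<close> have different
  colours among \<open>N\<close> values.\<close>

lemma ex1_sum_colour:
  assumes N: "odd N" and t: "t < Suc N" and c: "c < N"
  shows "\<exists>!e. e \<in> complete_edges (Suc N) \<and> t \<in> e \<and> sum_colour N e = c"
proof (rule ex_ex1I)
  let ?V = "{..<Suc N} - {t}" and ?h = "\<lambda>v. sum_colour N {t, v}"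
  have "0 < N"
    using c by simp
  have "inj_on ?h ?V"
    using sum_colour_inj[OF N t] by (auto intro!: inj_onI)
  then have "card (?h ` ?V) = N"
    using t by (simp add: card_image)
  moreover have "?h ` ?V \<subseteq> {..<N}"
    using sum_colour_less[OF \<open>0 < N\<close>] by auto
  ultimately have "?h ` ?V = {..<N}"
    by (intro card_subset_eq) auto
  then obtain v where "v \<in> ?V" "?h v = c"
    using c by (metis (no_types, lifting) imageE lessThan_iff)
  then show "\<exists>e. e \<in> complete_edges (Suc N) \<and> t \<in> e \<and> sum_colour N e = c"
    using t by (intro exI[of _ "{t, v}"]) (auto simp: complete_edges_pair)
next
  fix e f
  assume "e \<in> complete_edges (Suc N) \<and> t \<in> e \<and> sum_colour N e = c"
    and "f \<in> complete_edges (Suc N) \<and> t \<in> f \<and> sum_colour N f = c"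
  then show "e = f"
    using line_adj_proper[OF proper_sum_colour[OF N], of e f t] by auto
qed

definition edge_at :: "nat \<Rightarrow> nat \<Rightarrow> nat \<Rightarrow> nat set" where
  "edge_at N c t = (THE e. e \<in> complete_edges (Suc N) \<and> t \<in> e \<and> sum_colour N e = c)"

lemma edge_at:
  assumes "odd N" "t < Suc N" "c < N"
  shows "edge_at N c t \<in> complete_edges (Suc N)" "t \<in> edge_at N c t" "sum_colour N (edge_at N c t) = c"
  using theI'[OF ex1_sum_colour[OF assms]] by (simp_all add: edge_at_def)

lemma edge_at_unique:
  assumes "odd N" "e \<in> complete_edges (Suc N)" "t \<in> e"
  shows "edge_at N (sum_colour N e) t = e"
proof -
  have t: "t < Suc N"
    using assms by (auto simp: complete_edges_def)
  have "sum_colour N e < N"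
    using sum_colour_less assms by (metis odd_pos)
  then show ?thesis
    unfolding edge_at_def using assms by (intro the1_equality ex1_sum_colour t) auto
qed

lemma finite_complete_edges: "finite (complete_edges n)"
  by (rule finite_subset[of _ "Pow {0..<n}"]) (auto simp: complete_edges_def)

text \<open>A class is a perfect matching: its edges are disjoint pairs covering all
  \<open>Suc N\<close> vertices.\<close>

lemma card_sum_colour_class:
  assumes N: "odd N" and c: "c < N"
  shows "2 * card {e\<in>complete_edges (Suc N). sum_colour N e = c} = Suc N"
proof -
  let ?M = "{e\<in>complete_edges (Suc N). sum_colour N e = c}"
  have Union: "\<Union>?M = {0..<Suc N}"
  proof (intro equalityI subsetI)
    fix t assume "t \<in> {0..<Suc N}"
    then show "t \<in> \<Union>?M"
      using edge_at[OF N _ c, of t] by (intro UnionI[of "edge_at N c t"]) simp_all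
  next
    fix t assume "t \<in> \<Union>?M"
    then show "t \<in> {0..<Suc N}"
      unfolding complete_edges_def by blast
  qed
  moreover have "2 * card ?M = card (\<Union>?M)"
  proof (rule card_partition)
    fix e f assume ef: "e \<in> ?M" "f \<in> ?M" "e \<noteq> f"
    show "e \<inter> f = {}"
    proof (rule ccontr)
      assume "e \<inter> f \<noteq> {}"
      then obtain t where "t \<in> e" "t \<in> f" by blast
      then show False
        using ef line_adj_proper[OF proper_sum_colour[OF N], of e f t] by auto
    qed
  next
    show "finite ?M"
      using finite_complete_edges by simp
    show "finite (\<Union>?M)"
      unfolding Union by simp
    show "card e = 2" if "e \<in> ?M" for e
      using that by (simp add: complete_edges_def)
  qed
  ultimately show ?thesis
    by simp
qed

section \<open>Rigidity of three consecutive classes\<close>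

lemma third_value_le_2:
  fixes a b c d :: nat
  assumes "a \<le> 2" "b \<le> 2" "c \<le> 2" "d \<le> 2" "a \<noteq> b" "b \<noteq> c" "a \<noteq> c" "d \<noteq> a" "d \<noteq> c"
  shows "d = b"
  using assms by linarith

text \<open>The three consecutive classes form a ladder with a triangle at each end: starting from the
  vertex \<open>v\<close> with \<open>2 v = s + 1\<close>, the rungs join \<open>v + j\<close> and \<open>v - j\<close>, and a 3-edge-colouring is
  forced to show the same three colours at every vertex.\<close>

lemma three_classes_uniquely_colourable:
  assumes N: "odd N" and s: "s + 3 \<le> N"
    and x: "\<And>e. e \<in> complete_edges (Suc N) \<Longrightarrow> s \<le> sum_colour N e \<Longrightarrow> sum_colour N e < s + 3 \<Longrightarrow> x e \<le> (2 :: nat)"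
    and proper: "\<And>t i j. t < Suc N \<Longrightarrow> i < 3 \<Longrightarrow> j < 3 \<Longrightarrow> i \<noteq> j \<Longrightarrow> x (edge_at N (s + i) t) \<noteq> x (edge_at N (s + j) t)"
  obtains q where "bij_betw q {..2} {..2}"
    "\<And>t i. t < Suc N \<Longrightarrow> i < 3 \<Longrightarrow> x (edge_at N (s + i) t) = q i"
proof -
  define p where "p t i = x (edge_at N (s + i) t)" for t i
  have p_le: "p t i \<le> 2" if "t < Suc N" "i < 3" for t i
    using edge_at[OF N that(1), of "s + i"] that s unfolding p_def by (intro x) simp_all
  have p_ne: "p t i \<noteq> p t j" if "t < Suc N" "i < 3" "j < 3" "i \<noteq> j" for t i j
    using proper that by (simp add: p_def)
  have p_edge: "p t i = p t' i" if "{t, t'} \<in> complete_edges (Suc N)" "sum_colour N {t, t'} = s + i" for t t' i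
    using edge_at_unique[OF N that(1), of t] edge_at_unique[OF N that(1), of t'] that(2) by (simp add: p_def)
  \<comment> \<open>Finite vertices are addressed by integers modulo \<open>N\<close>, so that
    \<open>v - j\<close> always makes sense.\<close>
  define vtx where "vtx z = nat (z mod int N)" for z
  have "0 < N"
    using s by simp
  have vtx_less: "vtx z < N" for z
    using \<open>0 < N\<close> by (simp add: vtx_def nat_less_iff)
  have int_vtx: "int (vtx z) = z mod int N" for z
    using \<open>0 < N\<close> by (simp add: vtx_def)
  \<comment> \<open>If both residues agree there is no such edge, but the claim is trivial;
    otherwise the edge between them has colour \<open>s + i\<close>.\<close>
  have vtx_sum: "p (vtx y) i = p (vtx z) i" if "[y + z = int s + int i] (mod int N)" "i < 3" for y z i
  proof (cases "vtx y = vtx z")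
    case False
    have "int ((vtx y + vtx z) mod N) = (y + z) mod int N"
      by (simp add: of_nat_mod int_vtx mod_simps)
    also have "\<dots> = int (s + i)"
      using that s by (simp add: cong_def)
    finally have "sum_colour N {vtx y, vtx z} = s + i"
      using False vtx_less by (simp add: sum_colour_finite)
    then show ?thesis
      using False vtx_less[of y] vtx_less[of z] by (intro p_edge) (auto simp: complete_edges_pair)
  qed simp
  \<comment> \<open>\<open>v\<close> is the partner of infinity in the middle class.\<close>
  obtain v where v: "v < N" "(v + v) mod N = s + 1"
  proof -
    have "edge_at N (s + 1) N \<in> complete_edges (Suc N)" "N \<in> edge_at N (s + 1) N"
      using edge_at[OF N, of N "s + 1"] s by auto
    then obtain v where "edge_at N (s + 1) N = {N, v}" "v < Suc N" "N \<noteq> v"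
      by (rule complete_edgesE)
    moreover have "sum_colour N (edge_at N (s + 1) N) = s + 1"
      using edge_at[OF N, of N "s + 1"] s by auto
    ultimately show ?thesis
      using that[of v] by (simp add: sum_colour_infinity)
  qed
  have vv: "[int v + int v = int s + 1] (mod int N)"
  proof -
    have "int ((v + v) mod N) = int (s + 1)"
      using v by simp
    then show ?thesis
      using s by (simp add: of_nat_mod cong_def)
  qed
  define q where "q = p v"
  have ladder: "\<forall>i<3. p (vtx (int v + int j)) i = q i \<and> p (vtx (int v - int j)) i = q i" for j
  proof (induction j)
    case 0
    then show ?case
      using v by (simp add: q_def vtx_def)
  next
    case (Suc j)
    let ?a = "int v + int (Suc j)" and ?b = "int v - int (Suc j)"
    \<comment> \<open>Modulo \<open>N\<close>, \<open>?a\<close> and \<open>v - j\<close> sum to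
      \<open>s + 2\<close>, \<open>?b\<close> and \<open>v + j\<close> to \<open>s\<close>, and
      \<open>?a\<close> and \<open>?b\<close> to \<open>s + 1\<close>. So \<open>?a\<close> inherits
      the value at index 2, \<open>?b\<close> the value at index 0, and both agree at index
      1.\<close>
    have "[?a + (int v - int j) = int s + int 2] (mod int N)"
      using cong_add[OF vv cong_refl[of 1]] by (simp add: algebra_simps)
    then have a2: "p (vtx ?a) 2 = q 2"
      using vtx_sum[of ?a "int v - int j" 2] Suc.IH by simp
    have "[?b + (int v + int j) = int s + int 0] (mod int N)"
      using cong_diff[OF vv cong_refl[of 1]] by (simp add: algebra_simps)
    then have b0: "p (vtx ?b) 0 = q 0"
      using vtx_sum[of ?b "int v + int j" 0] Suc.IH by simp
    have "[?a + ?b = int s + int 1] (mod int N)"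
      using vv by (simp add: algebra_simps)
    then have ab: "p (vtx ?a) 1 = p (vtx ?b) 1"
      by (rule vtx_sum) simp
    note third = third_value_le_2[OF p_le p_le p_le p_le p_ne p_ne p_ne]
    have ends: "vtx ?a < Suc N" "vtx ?b < Suc N" "v < Suc N"
      using vtx_less[of ?a] vtx_less[of ?b] v by simp_all
    \<comment> \<open>The value shared along the rung avoids \<open>q 2\<close> at \<open>?a\<close>
      and \<open>q 0\<close> at \<open>?b\<close>, which leaves \<open>q 1\<close>; the remaining
      values follow.\<close>
    have "p (vtx ?a) 1 \<noteq> q 2" "p (vtx ?a) 1 \<noteq> q 0"
      using p_ne[OF ends(1), of 1 2] p_ne[OF ends(2), of 1 0] a2 b0 ab by simp_all
    then have a1: "p (vtx ?a) 1 = q 1"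
      using third[of v 0 1 2 "vtx ?a" 1] ends unfolding q_def by simp
    have "p (vtx ?a) 0 \<noteq> q 1" "p (vtx ?a) 0 \<noteq> q 2"
      using p_ne[OF ends(1), of 0 1] p_ne[OF ends(1), of 0 2] a1 a2 by simp_all
    then have a0: "p (vtx ?a) 0 = q 0"
      using third[of v 1 0 2 "vtx ?a" 0] ends unfolding q_def by simp
    have "p (vtx ?b) 2 \<noteq> q 0" "p (vtx ?b) 2 \<noteq> q 1"
      using p_ne[OF ends(2), of 2 0] p_ne[OF ends(2), of 2 1] a1 ab b0 by simp_all
    then have b2: "p (vtx ?b) 2 = q 2"
      using third[of v 0 2 1 "vtx ?b" 2] ends unfolding q_def by simp
    show ?case
    proof (intro allI impI)
      fix i :: nat assume "i < 3"
      then consider "i = 0" | "i = 1" | "i = 2"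
        by linarith
      then show "p (vtx ?a) i = q i \<and> p (vtx ?b) i = q i"
        using a0 a1 a2 b0 b2 ab by cases simp_all
    qed
  qed
  \<comment> \<open>\<open>j\<close> is unbounded, so upward steps alone reach every residue, with
    \<open>j = (t - v) mod N\<close>.\<close>
  have finite_vertex: "p t i = q i" if "t < N" "i < 3" for t i
  proof -
    have "[int v + int (nat ((int t - int v) mod int N)) = int t] (mod int N)"
      using \<open>0 < N\<close> by (simp add: cong_def mod_simps)
    then have "vtx (int v + int (nat ((int t - int v) mod int N))) = t"
      using that by (simp add: vtx_def cong_def)
    then show ?thesis
      using ladder[of "nat ((int t - int v) mod int N)"] that by metis
  qed
  have p_q: "p t i = q i" if "t < Suc N" "i < 3" for t i
  proof (cases "t = N")
    case True
    have e: "edge_at N (s + i) N \<in> complete_edges (Suc N)" "N \<in> edge_at N (s + i) N"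
      "sum_colour N (edge_at N (s + i) N) = s + i"
      using edge_at[OF N, of N "s + i"] s that by auto
    then obtain u where "edge_at N (s + i) N = {N, u}" "u < Suc N" "N \<noteq> u"
      using complete_edgesE by blast
    then show ?thesis
      using True e p_edge[of N u i] finite_vertex[of u i] that by simp
  next
    case False
    then show ?thesis
      using finite_vertex that by simp
  qed
  have "bij_betw q {..2} {..2}"
  proof -
    have "inj_on q {..2}"
      using p_ne[of v] v by (intro inj_onI) (metis atMost_iff le_imp_less_Suc less_SucI numeral_2_eq_2 numeral_3_eq_3 q_def)
    moreover have "q ` {..2} \<subseteq> {..2}"
      using p_le[of v] v by (auto simp: q_def)
    ultimately show ?thesis
      by (simp add: bij_betw_def endo_inj_surj)
  qed
  then show ?thesis
    using that[of q] p_q by (simp add: p_def)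
qed

section \<open>Blocks of three colours\<close>

lemma less_3_cases: "i = 0 \<or> i = 1 \<or> i = 2" if "i < (3 :: nat)"
  using that by linarith

text \<open>Lets one cyclically directed triangle per vertex stand for all conflicts between its
  three edges.\<close>

lemma less_3_successor:
  fixes i j :: nat
  assumes "i < 3" "j < 3" "i \<noteq> j"
  shows "j = Suc i mod 3 \<or> i = Suc j mod 3"
  using less_3_cases[OF assms(1)] less_3_cases[OF assms(2)] assms(3) by (elim disjE) simp_all

text \<open>Each vertex contributes a directed triangle on its three edges, and each edge lies in
  two triangles, whence \<open>d = 2\<close>. By uniqueness a proper colouring shows the same
  permutation \<open>q\<close> at every vertex, which determines its term.\<close>

lemma choosable_three_consecutive_classes:
  assumes N: "odd N" and s: "s + 3 \<le> N"
  shows "choosable {e\<in>complete_edges (Suc N). s \<le> sum_colour N e \<and> sum_colour N e < s + 3}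
           (line_adj (complete_edges (Suc N))) 3"
  unfolding choosable_def
proof (intro allI impI)
  let ?E = "complete_edges (Suc N)"
  let ?W = "{e\<in>?E. s \<le> sum_colour N e \<and> sum_colour N e < s + 3}"
  fix L :: "nat set \<Rightarrow> nat set"
  assume L: "\<forall>e\<in>?W. finite (L e) \<and> card (L e) = 3"
  define T where "T = {..<Suc N} \<times> {..<3::nat}"
  define src where "src t = edge_at N (s + snd t) (fst t)" for t
  \<comment> \<open>\<open>mod\<close> binds tighter than \<open>+\<close>: the cyclic successor is
    that of the index inside the block.\<close>
  define tgt where "tgt t = edge_at N (s + Suc (snd t) mod 3) (fst t)" for t
  define M where "M i = {e\<in>?E. sum_colour N e = s + i}" for i
  have edge: "edge_at N (s + i) t \<in> ?W" "sum_colour N (edge_at N (s + i) t) = s + i" if "t < Suc N" "i < 3" for t i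
    using edge_at[OF N that(1), of "s + i"] s that by auto
  have ends: "src t \<in> ?W" "tgt t \<in> ?W" if "t \<in> T" for t
    unfolding src_def tgt_def using that by (intro edge; force simp: T_def)+
  have W_M: "?W = (\<Union>i\<in>{..<3}. M i)"
  proof (intro equalityI subsetI)
    fix e assume "e \<in> ?W"
    then show "e \<in> (\<Union>i\<in>{..<3}. M i)"
      by (intro UN_I[of "sum_colour N e - s"]) (auto simp: M_def)
  qed (auto simp: M_def)
  have M_fin: "finite (M i)" for i
    using finite_complete_edges by (simp add: M_def)
  have M_disj: "M i \<inter> M j = {}" if "i \<noteq> j" for i j
    using that by (auto simp: M_def)
  have M_card: "card (M i) = Suc N div 2" if "i < 3" for i
    using card_sum_colour_class[OF N, of "s + i"] that s by (simp add: M_def)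
  have W_fin: "finite ?W"
    using finite_complete_edges by simp
  have W_card: "card ?W = 3 * (Suc N div 2)"
    unfolding W_M using M_fin M_disj M_card by (subst card_UN_disjoint) auto
  have even_N: "2 * (Suc N div 2) = Suc N"
    using N by simp
  have bij3: "{..<3} = {..2::nat}"
    by auto
  \<comment> \<open>4 is the squared contribution of one vertex; \<open>Suc N div 2\<close> is both
    the number of pairs of vertices and the size of a class.\<close>
  let ?c = "4 ^ (Suc N div 2) * (\<Prod>i\<le>2. lagrange_weight {..2} i) ^ (Suc N div 2)"
  have proper: "x (edge_at N (s + i) t) \<noteq> x (edge_at N (s + j) t)"
    if x: "\<And>t. t \<in> T \<Longrightarrow> x (src t) \<noteq> x (tgt t)" and "t < Suc N" "i < 3" "j < 3" "i \<noteq> j"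
    for x :: "nat set \<Rightarrow> nat" and t i j
  proof -
    from less_3_successor[OF that(3-5)] show ?thesis
    proof
      assume "j = Suc i mod 3"
      then show ?thesis
        using x[of "(t, i)"] that(2,3) by (simp add: T_def src_def tgt_def)
    next
      assume "i = Suc j mod 3"
      then show ?thesis
        using x[of "(t, j)"] that(2,4) by (simp add: T_def src_def tgt_def)
    qed
  qed
  have "\<exists>f. (\<forall>e\<in>?W. f e \<in> L e) \<and> (\<forall>t\<in>T. f (src t) \<noteq> f (tgt t))"
  proof (rule alon_tarsi_list_colouring[where d = 2 and y = "\<lambda>e. sum_colour N e - s" and c = ?c])
    show "card T = 2 * card ?W"
      using W_card even_N by (simp add: T_def)
    show "sum_colour N (src t) - s \<noteq> sum_colour N (tgt t) - s" if t: "t \<in> T" for t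
    proof -
      have t: "fst t < Suc N" "snd t < 3"
        using t by (auto simp: T_def)
      have "snd t \<noteq> Suc (snd t) mod 3"
        using less_3_cases[OF t(2)] by (elim disjE) simp_all
      with t show ?thesis
        using edge(2)[of "fst t" "snd t"] edge(2)[of "fst t" "Suc (snd t) mod 3"]
        by (simp add: src_def tgt_def)
    qed
    show "?c \<noteq> 0"
      by (simp add: lagrange_weight_nonzero)
    fix x assume x_le: "x \<in> ?W \<rightarrow> {..2::nat}" and x: "\<And>t. t \<in> T \<Longrightarrow> x (src t) \<noteq> x (tgt t)"
    have x_le': "x e \<le> 2" if "e \<in> ?E" "s \<le> sum_colour N e" "sum_colour N e < s + 3" for e
      using x_le that by auto
    have x_ne: "x (edge_at N (s + i) t) \<noteq> x (edge_at N (s + j) t)"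
      if "t < Suc N" "i < 3" "j < 3" "i \<noteq> j" for t i j
      using x that by (rule proper)
    obtain q where q: "bij_betw q {..2} {..2}"
      and x_q: "\<And>t i. t < Suc N \<Longrightarrow> i < 3 \<Longrightarrow> x (edge_at N (s + i) t) = q i"
      using three_classes_uniquely_colourable[where x = x, OF N s x_le' x_ne] by blast
    have x_M: "x e = q i" if e: "e \<in> M i" "i < 3" for e i
    proof -
      have "e \<subseteq> {0..<Suc N}" "e \<noteq> {}"
        using e(1) by (auto simp: M_def complete_edges_def)
      then obtain t where "t \<in> e"
        by blast
      moreover from this have "t < Suc N"
        using \<open>e \<subseteq> {0..<Suc N}\<close> by auto
      ultimately show ?thesis
        using x_q[of t i] edge_at_unique[OF N, of e t] e by (simp add: M_def)
    qed
    \<comment> \<open>\<open>D\<close> is the contribution of one vertex, twice the sign of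
      \<open>q\<close>; squaring removes the sign.\<close>
    define D where "D = (\<Prod>i<3. real (q i) - real (q (Suc i mod 3)))"
    have "D ^ 2 = 4"
    proof -
      have "q ` {..2} \<subseteq> {..2}" "inj_on q {..2}"
        using q by (auto simp: bij_betw_def)
      then have le: "q i < 3" if "i \<le> 2" for i
        using that by (force simp: image_subset_iff)
      have ne: "q 0 \<noteq> q 1" "q 1 \<noteq> q 2" "q 0 \<noteq> q 2"
        using \<open>inj_on q {..2}\<close> by (simp_all add: inj_on_eq_iff[of q "{..2}"])
      have "{..<3} = {0, 1, 2 :: nat}"
        by auto
      then have "D = (real (q 0) - real (q 1)) * (real (q 1) - real (q 2)) * (real (q 2) - real (q 0))"
        by (simp add: D_def flip: numeral_2_eq_2)
      then show ?thesis
        using less_3_cases[of "q 0"] less_3_cases[of "q 1"] less_3_cases[of "q 2"] le[of 0] le[of 1] le[of 2] ne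
        by auto
    qed
    have "(\<Prod>t\<in>T. real (x (src t)) - real (x (tgt t))) = (\<Prod>t\<in>{..<Suc N}. D)"
      unfolding T_def prod.cartesian_product' D_def
      using x_q by (intro prod.cong refl) (auto simp: src_def tgt_def)
    also have "\<dots> = D ^ Suc N"
      by simp
    also have "\<dots> = (D ^ 2) ^ (Suc N div 2)"
      by (metis even_N power_mult)
    finally have edges: "(\<Prod>t\<in>T. real (x (src t)) - real (x (tgt t))) = 4 ^ (Suc N div 2)"
      using \<open>D ^ 2 = 4\<close> by simp
    \<comment> \<open>All edges of \<open>M i\<close> have colour \<open>q i\<close> and the classes
      have equal size, so the product does not depend on the permutation.\<close>
    have "(\<Prod>e\<in>?W. lagrange_weight {..2} (x e)) = (\<Prod>i<3. \<Prod>e\<in>M i. lagrange_weight {..2} (x e))"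
      unfolding W_M using M_fin M_disj by (subst prod.UNION_disjoint) auto
    also have "\<dots> = (\<Prod>i<3. lagrange_weight {..2} (q i) ^ (Suc N div 2))"
      using x_M M_card by (intro prod.cong refl) simp
    also have "\<dots> = (\<Prod>i\<le>2. lagrange_weight {..2} (q i)) ^ (Suc N div 2)"
      by (simp add: prod_power_distrib bij3)
    also have "(\<Prod>i\<le>2. lagrange_weight {..2} (q i)) = (\<Prod>i\<le>2. lagrange_weight {..2} i)"
      by (rule prod.reindex_bij_betw[OF q])
    finally show "alon_tarsi_term ?W T src tgt (\<lambda>_. {..2}) x = ?c"
      using edges by (simp add: alon_tarsi_term_def)
  qed (use W_fin L ends in \<open>auto simp: T_def\<close>)
  then obtain f where f: "\<And>e. e \<in> ?W \<Longrightarrow> f e \<in> L e" "\<And>t. t \<in> T \<Longrightarrow> f (src t) \<noteq> f (tgt t)"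
    by blast
  \<comment> \<open>Adjacent edges share a vertex and lie in different classes, so its triangle
    separates them.\<close>
  have "f u \<noteq> f v" if uv: "u \<in> ?W" "v \<in> ?W" "line_adj ?E u v" for u v
  proof -
    obtain t where t: "t \<in> u" "t \<in> v"
      using uv by (auto simp: line_adj_def)
    then have "t < Suc N"
      using uv by (auto simp: complete_edges_def)
    moreover have "sum_colour N u \<noteq> sum_colour N v"
      using proper_sum_colour[OF N] uv by (auto simp: proper_on_def)
    moreover have "edge_at N (sum_colour N u) t = u" "edge_at N (sum_colour N v) t = v"
      using edge_at_unique[OF N] uv t by auto
    moreover have "sum_colour N u - s < 3" "sum_colour N v - s < 3"
      "s \<le> sum_colour N u" "s \<le> sum_colour N v"
      using uv(1,2) by auto
    ultimately show ?thesis
      using proper[of f t "sum_colour N u - s" "sum_colour N v - s"] f(2) by simp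
  qed
  then show "\<exists>f. (\<forall>e\<in>?W. f e \<in> L e) \<and> proper_on ?W (line_adj ?E) f"
    using f(1) by (auto simp: proper_on_def)
qed

section \<open>Edge choosability for parts of size up to two and up to three\<close>

theorem theorem10:
  shows "(\<forall>(V :: 'a set) E k lam.
            simple_graph V E \<and> edge_colourable E k \<and> is_partition lam k \<and>
            (\<forall>x\<in>#lam. x \<le> 2)
            \<longrightarrow> edge_lambda_choosable E k lam)
       \<and> (\<forall>(n :: nat) lam.
            even n \<and> 0 < n \<and> is_partition lam (n - 1) \<and> (\<forall>x\<in>#lam. x \<le> 3)
            \<longrightarrow> edge_lambda_choosable (complete_edges n) (n - 1) lam)"
proof (intro conjI allI impI; elim conjE)
  fix V :: "'a set" and E k lam
  assume E: "simple_graph V E" "edge_colourable E k" and lam: "is_partition lam k" "\<forall>x\<in>#lam. x \<le> 2"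
  then obtain g :: "'a set \<Rightarrow> nat" where g: "\<And>e. e \<in> E \<Longrightarrow> g e < k" "proper_on E (line_adj E) g"
    by (auto simp: edge_colourable_def colourable_def)
  show "edge_lambda_choosable E k lam"
    unfolding edge_lambda_choosable_def
  proof (rule lambda_choosable_of_blocks[where g = g])
    show "sum_mset lam = k"
      using lam by (simp add: is_partition_def)
    fix s r assume "r \<in># lam"
    then have "0 < r" "r \<le> 2"
      using lam by (auto simp: is_partition_def)
    then show "choosable {e\<in>E. s \<le> g e \<and> g e < s + r} (line_adj E) r"
      by (rule choosable_block_le_2[OF E(1) g(2)])
  qed (rule g(1))
next
  fix n :: nat and lam
  assume n: "even n" "0 < n" and lam: "is_partition lam (n - 1)" "\<forall>x\<in>#lam. x \<le> 3"
  define N where "N = n - 1"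
  have N: "odd N" "n = Suc N"
    using n by (auto simp: N_def)
  have graph: "simple_graph {0..<Suc N} (complete_edges (Suc N))"
    by (auto simp: simple_graph_def complete_edges_def)
  have "lambda_choosable (complete_edges (Suc N)) (line_adj (complete_edges (Suc N))) N lam"
  proof (rule lambda_choosable_of_blocks[where g = "sum_colour N"])
    show "sum_mset lam = N"
      using lam by (simp add: is_partition_def N_def)
    show "sum_colour N e < N" for e
      using N sum_colour_less by (metis odd_pos)
    \<comment> \<open>\<open>s + r \<le> N\<close> keeps a run of consecutive classes from wrapping
      around modulo \<open>N\<close>.\<close>
    fix s r assume r: "r \<in># lam" "s + r \<le> N"
    then have "0 < r" "r \<le> 3"
      using lam by (auto simp: is_partition_def)
    show "choosable {e \<in> complete_edges (Suc N). s \<le> sum_colour N e \<and> sum_colour N e < s + r}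
        (line_adj (complete_edges (Suc N))) r"
    proof (cases "r = 3")
      case True
      then show ?thesis
        using choosable_three_consecutive_classes[OF N(1)] r by simp
    next
      case False
      then show ?thesis
        using \<open>0 < r\<close> \<open>r \<le> 3\<close> by (intro choosable_block_le_2[OF graph proper_sum_colour[OF N(1)]]) simp_all
    qed
  qed
  then show "edge_lambda_choosable (complete_edges n) (n - 1) lam"
    by (simp add: edge_lambda_choosable_def N)
qed

end
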